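(* Let $\Phi:(\mathcal{P}_2(\mathbb{R}^d),\mathcal{W}_2)\to\mathbb{R}$ be a continuous function. (a) $\Phi$ is non-decreasing with respect to the convex order (i.e. $\mu\preceq_{cv}\nu$ implies $\Phi(\mu)\le\Phi(\nu)$ for $\mu,\nu\in\mathcal{P}_2(\mathbb{R}^d)$) if and only if for every $\mu,\nu\in\mathcal{P}_2(\mathbb{R}^d)$ with $\mu\preceq_{cv}\nu$, $$\liminf_{\varepsilon\to0^+}\frac{\Phi\big(\mu+\varepsilon(\nu-\mu)\big)-\Phi(\mu)}{\varepsilon}\ge0.$$ (b) Assume that $\Phi$ is linearly functionally differentiable with linear functional derivative $\frac{\delta\Phi}{\delta m}$ defined on $\mathcal{P}_2(\mathbb{R}^d)\times\mathbb{R}^d$. Then the following are equivalent: (i) $\Phi$ is non-decreasing with respect to the convex order on $\mathcal{P}_2(\mathbb{R}^d)$; (ii) for every $\mu,\nu\in\mathcal{P}_2(\mathbb{R}^d)$ with $\mu\preceq_{cv}\nu$, $\displaystyle\int_{\mathbb{R}^d}\frac{\delta\Phi}{\delta m}(\mu)(x)\,d(\nu-\mu)(x)\ge0$. (c) In particular (with $\Phi$ linearly functionally differentiable as in (b)), if for every $\mu\in\mathcal{P}_2(\mathbb{R}^d)$ the function $x\mapsto\frac{\delta\Phi}{\delta m}(\mu)(x)$ is convex, then $\Phi$ is non-decreasing for the convex order on $\mathcal{P}_2(\mathbb{R}^d)$.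
   Context: $\mathcal{P}_2(\mathbb{R}^d)$ is the set of probability distributions on $\mathbb{R}^d$ with finite second moment and $\mathcal{W}_2$ the $L^2$-Wasserstein distance. Convex order: $\mu\preceq_{cv}\nu$ means $\int\varphi\,d\mu\le\int\varphi\,d\nu$ for every convex $\varphi:\mathbb{R}^d\to\mathbb{R}$ (integrals in $(-\infty,+\infty]$). $\Phi$ is linearly functionally differentiable with linear functional derivative $\frac{\delta\Phi}{\delta m}:\mathcal{P}_2(\mathbb{R}^d)\times\mathbb{R}^d\to\mathbb{R}$, $(\mu,x)\mapsto\frac{\delta\Phi}{\delta m}(\mu)(x)$, if this map is jointly continuous in $(\mu,x)$, if for every $\mathcal{W}_2$-bounded $\mathcal{K}\subset\mathcal{P}_2(\mathbb{R}^d)$ the function $x\mapsto\frac{\delta\Phi}{\delta m}(\mu)(x)$ has at most quadratic growth uniformly in $\mu\in\mathcal{K}$, and if for all $\mu,\mu'\in\mathcal{P}_2(\mathbb{R}^d)$ $$\Phi(\mu')-\Phi(\mu)=\int_0^1\int_{\mathbb{R}^d}\frac{\delta\Phi}{\delta m}\big(t\mu'+(1-t)\mu\big)(x)\,d(\mu'-\mu)(x)\,dt.$$ *)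

theory Defs
  imports "HOL-Probability.Probability"
begin

definition P2 :: "'a::euclidean_space measure set" where
  "P2 = {\<mu>. prob_space \<mu> \<and> sets \<mu> = sets borel \<and> integrable \<mu> (\<lambda>x. (norm x)\<^sup>2)}"

definition couplings ::
  "'a::euclidean_space measure \<Rightarrow> 'a measure \<Rightarrow> ('a \<times> 'a) measure set" where
  "couplings \<mu> \<nu> =
    {\<pi>. prob_space \<pi> \<and> sets \<pi> = sets borel \<and> distr \<pi> borel fst = \<mu> \<and> distr \<pi> borel snd = \<nu>}"

text \<open>The infimum is taken in \<^typ>\<open>ennreal\<close>; it is finite whenever \<mu> and \<nu> lie in
  \<^const>\<open>P2\<close>, so the conversion to a real number loses nothing there.\<close>

definition W2 :: "'a::euclidean_space measure \<Rightarrow> 'a measure \<Rightarrow> real" where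
  "W2 \<mu> \<nu> =
    sqrt (enn2real (INF \<pi>\<in>couplings \<mu> \<nu>. \<integral>\<^sup>+ z. ennreal ((dist (fst z) (snd z))\<^sup>2) \<partial>\<pi>))"

definition W2_bounded :: "'a::euclidean_space measure set \<Rightarrow> bool" where
  "W2_bounded K \<longleftrightarrow> (\<exists>R. \<forall>\<mu>\<in>K. \<forall>\<nu>\<in>K. W2 \<mu> \<nu> \<le> R)"

definition W2_continuous :: "('a::euclidean_space measure \<Rightarrow> real) \<Rightarrow> bool" where
  "W2_continuous \<Phi> \<longleftrightarrow>
    (\<forall>\<mu>\<in>P2. \<forall>e>0. \<exists>r>0. \<forall>\<nu>\<in>P2. W2 \<nu> \<mu> < r \<longrightarrow> \<bar>\<Phi> \<nu> - \<Phi> \<mu>\<bar> < e)"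

text \<open>Integral with values in the extended reals, as positive part minus negative part. If \<phi> is
  convex and \<mu> is in \<^const>\<open>P2\<close>, then \<phi> is bounded below by an affine function, so the negative
  part has a finite integral and the convention for the difference of two infinities in
  \<^typ>\<open>ereal\<close> is never used.\<close>

definition ext_integral :: "'a measure \<Rightarrow> ('a \<Rightarrow> real) \<Rightarrow> ereal" where
  "ext_integral \<mu> \<phi> =
    enn2ereal (\<integral>\<^sup>+ x. ennreal (\<phi> x) \<partial>\<mu>) - enn2ereal (\<integral>\<^sup>+ x. ennreal (- \<phi> x) \<partial>\<mu>)"

definition convex_order :: "'a::euclidean_space measure \<Rightarrow> 'a measure \<Rightarrow> bool"
    (infix "\<preceq>cv" 50) where
  "\<mu> \<preceq>cv \<nu> \<longleftrightarrow> (\<forall>\<phi>. convex_on UNIV \<phi> \<longrightarrow> ext_integral \<mu> \<phi> \<le> ext_integral \<nu> \<phi>)"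

definition cv_nondecreasing :: "('a::euclidean_space measure \<Rightarrow> real) \<Rightarrow> bool" where
  "cv_nondecreasing \<Phi> \<longleftrightarrow> (\<forall>\<mu>\<in>P2. \<forall>\<nu>\<in>P2. \<mu> \<preceq>cv \<nu> \<longrightarrow> \<Phi> \<mu> \<le> \<Phi> \<nu>)"

text \<open>The probability measure \<mu> + t (\<nu> - \<mu>) = (1 - t) \<mu> + t \<nu>; meaningful only for t between
  0 and 1, since \<^const>\<open>ennreal\<close> truncates negative weights to 0.\<close>

definition mixture ::
  "real \<Rightarrow> 'a::euclidean_space measure \<Rightarrow> 'a measure \<Rightarrow> 'a measure" where
  "mixture t \<mu> \<nu> = measure_of UNIV (sets borel)
    (\<lambda>A. ennreal (1 - t) * emeasure \<mu> A + ennreal t * emeasure \<nu> A)"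

lemma sets_mixture [simp]: "sets (mixture t \<mu> \<nu>) = sets borel"
  unfolding mixture_def by (metis sets.sets_measure_of_eq space_borel)

lemma emeasure_mixture:
  assumes "sets \<mu> = sets borel" "sets \<nu> = sets borel" "A \<in> sets borel"
  shows "emeasure (mixture t \<mu> \<nu>) A = ennreal (1 - t) * emeasure \<mu> A + ennreal t * emeasure \<nu> A"
proof (rule emeasure_measure_of[OF mixture_def])
  show "countably_additive (sets (mixture t \<mu> \<nu>))
    (\<lambda>A. ennreal (1 - t) * emeasure \<mu> A + ennreal t * emeasure \<nu> A)"
    unfolding countably_additive_def
  proof (intro allI impI)
    fix B :: "nat \<Rightarrow> 'a set"
    assume B: "range B \<subseteq> sets (mixture t \<mu> \<nu>)" "disjoint_family B"
    then have "range B \<subseteq> sets \<mu>" "range B \<subseteq> sets \<nu>" using assms by auto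
    then show "(\<Sum>i. ennreal (1 - t) * emeasure \<mu> (B i) + ennreal t * emeasure \<nu> (B i)) =
      ennreal (1 - t) * emeasure \<mu> (\<Union>i. B i) + ennreal t * emeasure \<nu> (\<Union>i. B i)"
      using B by (simp add: suminf_add[symmetric] suminf_emeasure)
  qed
qed (use assms in \<open>auto simp: positive_def\<close>)

definition diff_integral :: "'a measure \<Rightarrow> 'a measure \<Rightarrow> ('a \<Rightarrow> real) \<Rightarrow> real" where
  "diff_integral \<nu> \<mu> f = (\<integral>x. f x \<partial>\<nu>) - (\<integral>x. f x \<partial>\<mu>)"

definition jointly_continuous ::
  "('a::euclidean_space measure \<Rightarrow> 'a \<Rightarrow> real) \<Rightarrow> bool" where
  "jointly_continuous D \<longleftrightarrow>
    (\<forall>\<mu>\<in>P2. \<forall>x. \<forall>e>0. \<exists>r>0. \<forall>\<nu>\<in>P2. \<forall>y.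
      W2 \<nu> \<mu> < r \<and> dist y x < r \<longrightarrow> \<bar>D \<nu> y - D \<mu> x\<bar> < e)"

definition locally_quadratic_growth ::
  "('a::euclidean_space measure \<Rightarrow> 'a \<Rightarrow> real) \<Rightarrow> bool" where
  "locally_quadratic_growth D \<longleftrightarrow>
    (\<forall>K\<subseteq>P2. W2_bounded K \<longrightarrow> (\<exists>C. \<forall>\<mu>\<in>K. \<forall>x. \<bar>D \<mu> x\<bar> \<le> C * (1 + (norm x)\<^sup>2)))"

definition linear_functional_derivative ::
  "('a::euclidean_space measure \<Rightarrow> real) \<Rightarrow> ('a measure \<Rightarrow> 'a \<Rightarrow> real) \<Rightarrow> bool" where
  "linear_functional_derivative \<Phi> D \<longleftrightarrow>
    jointly_continuous D \<and> locally_quadratic_growth D \<and>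
    (\<forall>\<mu>\<in>P2. \<forall>\<mu>'\<in>P2.
      \<Phi> \<mu>' - \<Phi> \<mu> = (LINT t:{0..1}|lborel. diff_integral \<mu>' \<mu> (D (mixture t \<mu> \<mu>'))))"

end

theory Submission
  imports Defs
begin

text \<open>The order \<mu> \<preceq>cv \<nu> makes the segment \<open>mixture t \<mu> \<nu>\<close> increasing for the convex order.
  Along it \<Phi> is a continuous function of \<open>t\<close>, because moving a mass \<open>\<bar>t - s\<bar>\<close> through a
  product coupling costs at most a multiple of \<open>\<bar>t - s\<bar>\<close>; its lower right Dini derivative at
  \<open>t\<close> is controlled by the hypothesis applied to \<open>mixture t \<mu> \<nu> \<preceq>cv \<nu>\<close>, and a continuous
  function with nonnegative Dini derivative is nondecreasing. In the differentiable case
  \<open>\<integral> D(\<mu>\<^sub>t) d(\<nu> - \<mu>\<^sub>t) = (1 - t) \<integral> D(\<mu>\<^sub>t) d(\<nu> - \<mu>)\<close> gives the sign of the integrand in the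
  fundamental formula, and conversely a negative value at \<open>t = 0\<close> persists for small \<open>t\<close> by
  dominated convergence.\<close>

section \<open>Mixtures of measures: integrals, algebra and images\<close>

lemma space_mixture [simp]: "space (mixture t \<mu> \<nu>) = UNIV"
  using sets_eq_imp_space_eq[OF sets_mixture, of t \<mu> \<nu>] by simp

lemma measurable_mixture [simp]:
  "measurable (mixture t \<mu> \<nu>) N = measurable borel N"
  by (rule measurable_cong_sets) simp_all

lemma mixture_eqI:
  assumes "sets \<rho> = sets borel" "sets \<mu> = sets borel" "sets \<nu> = sets borel"
    and "\<And>A. A \<in> sets borel \<Longrightarrow>
      emeasure \<rho> A = ennreal (1 - t) * emeasure \<mu> A + ennreal t * emeasure \<nu> A"
  shows "mixture t \<mu> \<nu> = \<rho>"
  by (rule measure_eqI) (use assms in \<open>auto simp: emeasure_mixture\<close>)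

text \<open>Both sides are linear in \<open>f\<close> and commute with increasing limits, so the
  identity spreads from indicators, where it is \<open>emeasure_mixture\<close>.\<close>

lemma nn_integral_mixture:
  assumes [measurable_cong, simp]: "sets \<mu> = sets borel" "sets \<nu> = sets borel"
    and "f \<in> borel_measurable borel"
  shows "(\<integral>\<^sup>+x. f x \<partial>mixture t \<mu> \<nu>) =
    ennreal (1 - t) * (\<integral>\<^sup>+x. f x \<partial>\<mu>) + ennreal t * (\<integral>\<^sup>+x. f x \<partial>\<nu>)"
  using assms(3)
proof (induction rule: borel_measurable_induct)
  case (cong f g)
  then have "f = g" by auto
  with cong show ?case by simp
next
  case (set A)
  then show ?case by (simp add: emeasure_mixture)
next
  case (mult u c)
  then show ?case by (simp add: nn_integral_cmult algebra_simps)
next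
  case (add u v)
  then show ?case by (simp add: nn_integral_add algebra_simps)
next
  case (seq U)
  have SUP: "integral\<^sup>N M (SUP i. U i) = (SUP i. integral\<^sup>N M (U i))"
    if "sets M = sets borel" for M
    using nn_integral_monotone_convergence_SUP[of U M] seq(1,3) that
    by (simp add: image_comp measurable_cong_sets[of M borel] SUP_apply[abs_def])
  \<comment> \<open>In \<open>ennreal\<close> the supremum of a sum of two sequences splits into the
    two suprema because both sequences increase.\<close>
  have "incseq (\<lambda>i. integral\<^sup>N M (U i))" for M
    using seq(3) by (auto simp: incseq_def le_fun_def intro!: nn_integral_mono)
  then have mono: "incseq (\<lambda>i. c * integral\<^sup>N M (U i))" for M c
    by (auto simp: incseq_def intro!: mult_left_mono)
  have "integral\<^sup>N (mixture t \<mu> \<nu>) (SUP i. U i) =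
      (SUP i. ennreal (1 - t) * integral\<^sup>N \<mu> (U i) + ennreal t * integral\<^sup>N \<nu> (U i))"
    using seq by (simp add: SUP image_comp)
  also have "\<dots> = ennreal (1 - t) * (SUP i. integral\<^sup>N \<mu> (U i)) + ennreal t * (SUP i. integral\<^sup>N \<nu> (U i))"
    by (simp add: ennreal_SUP_add[OF mono mono] SUP_mult_left_ennreal)
  finally show ?case by (simp only: SUP assms)
qed

lemma integrable_mixture:
  fixes f :: "'a::euclidean_space \<Rightarrow> real"
  assumes [measurable_cong, simp]: "sets \<mu> = sets borel" "sets \<nu> = sets borel"
    and "integrable \<mu> f" "integrable \<nu> f"
  shows "integrable (mixture t \<mu> \<nu>) f"
proof -
  have f [measurable]: "f \<in> borel_measurable borel"
    using borel_measurable_integrable[OF assms(3)] by (simp add: measurable_cong_sets[of \<mu> borel])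
  show ?thesis
    using assms(3,4) unfolding integrable_iff_bounded
    by (auto simp: nn_integral_mixture ennreal_mult_less_top)
qed

lemma integral_mixture:
  fixes f :: "'a::euclidean_space \<Rightarrow> real"
  assumes [measurable_cong, simp]: "sets \<mu> = sets borel" "sets \<nu> = sets borel"
    and i: "integrable \<mu> f" "integrable \<nu> f" and t: "0 \<le> t" "t \<le> 1"
  shows "(\<integral>x. f x \<partial>mixture t \<mu> \<nu>) = (1 - t) * (\<integral>x. f x \<partial>\<mu>) + t * (\<integral>x. f x \<partial>\<nu>)"
proof -
  have f [measurable]: "f \<in> borel_measurable borel"
    using borel_measurable_integrable[OF i(1)] by (simp add: measurable_cong_sets[of \<mu> borel])
  \<comment> \<open>\<open>enn2real\<close> sends \<top> to 0 and is additive on finite values, so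
    the positive and the negative part must both have finite integral.\<close>
  have fin: "(\<integral>\<^sup>+x. ennreal (f x) \<partial>M) < \<top>" "(\<integral>\<^sup>+x. ennreal (- f x) \<partial>M) < \<top>"
    if "integrable M f" for M
    using that by (auto simp: real_integrable_def less_top)
  show ?thesis
    using i fin[OF i(1)] fin[OF i(2)] integrable_mixture[OF assms(1-4)] t
    by (simp add: real_lebesgue_integral_def nn_integral_mixture enn2real_plus
        ennreal_mult_less_top enn2real_mult algebra_simps)
qed

lemma mixture_0 [simp]:
  assumes "sets \<mu> = sets borel" "sets \<nu> = sets borel"
  shows "mixture 0 \<mu> \<nu> = \<mu>"
  by (rule mixture_eqI) (use assms in auto)

lemma mixture_1 [simp]:
  assumes "sets \<mu> = sets borel" "sets \<nu> = sets borel"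
  shows "mixture 1 \<mu> \<nu> = \<nu>"
  by (rule mixture_eqI) (use assms in auto)

lemma mixture_commute:
  assumes "sets \<mu> = sets borel" "sets \<nu> = sets borel"
  shows "mixture t \<mu> \<nu> = mixture (1 - t) \<nu> \<mu>"
  by (rule mixture_eqI) (use assms in \<open>auto simp: emeasure_mixture add.commute\<close>)

lemma mixture_mixture_left:
  assumes "sets \<mu> = sets borel" "sets \<nu> = sets borel" "0 \<le> r" "r \<le> 1" "0 \<le> s" "s \<le> 1"
  shows "mixture r \<mu> (mixture s \<mu> \<nu>) = mixture (r * s) \<mu> \<nu>"
proof (rule mixture_eqI)
  fix A :: "'a set" assume A: "A \<in> sets borel"
  \<comment> \<open>The weight of \<mu> is written as a sum of nonnegative reals, on which
    \<open>ennreal\<close> is additive.\<close>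
  have eq: "ennreal (1 - r * s) = ennreal (1 - r) + ennreal r * ennreal (1 - s)"
  proof -
    have "ennreal (1 - r * s) = ennreal ((1 - r) + r * (1 - s))"
      by (simp add: algebra_simps)
    also have "\<dots> = ennreal (1 - r) + ennreal r * ennreal (1 - s)"
      using assms by (simp add: ennreal_mult)
    finally show ?thesis .
  qed
  show "emeasure (mixture (r * s) \<mu> \<nu>) A =
      ennreal (1 - r) * emeasure \<mu> A + ennreal r * emeasure (mixture s \<mu> \<nu>) A"
    using assms A by (simp add: emeasure_mixture eq distrib_left distrib_right ennreal_mult mult.assoc add.assoc)
qed (use assms in auto)

text \<open>Swapping the end points reduces this to \<open>mixture_mixture_left\<close>. It restarts
  the segment at an interior point, where the derivative hypothesis is applied.\<close>

lemma mixture_mixture_right: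
  assumes "sets \<mu> = sets borel" "sets \<nu> = sets borel" "0 \<le> r" "r \<le> 1" "0 \<le> s" "s \<le> 1"
  shows "mixture r (mixture s \<mu> \<nu>) \<nu> = mixture (s + r * (1 - s)) \<mu> \<nu>"
proof -
  have "mixture r (mixture s \<mu> \<nu>) \<nu> = mixture (1 - r) \<nu> (mixture (1 - s) \<nu> \<mu>)"
    using assms by (simp add: mixture_commute[of _ \<nu> r] mixture_commute[of \<mu> \<nu> s])
  also have "\<dots> = mixture (1 - (s + r * (1 - s))) \<nu> \<mu>"
    using assms by (simp add: mixture_mixture_left algebra_simps)
  finally show ?thesis
    using assms by (simp add: mixture_commute[of \<mu> \<nu> "s + r * (1 - s)"])
qed

text \<open>Applied to the two projections, it computes the marginals of a mixture of
  couplings.\<close>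

lemma distr_mixture:
  assumes [measurable_cong, simp]: "sets \<mu> = sets borel" "sets \<nu> = sets borel"
    and f [measurable]: "f \<in> borel_measurable borel"
  shows "distr (mixture t \<mu> \<nu>) borel f = mixture t (distr \<mu> borel f) (distr \<nu> borel f)"
proof (rule mixture_eqI[symmetric])
  have sp: "space \<mu> = UNIV" "space \<nu> = UNIV"
    using sets_eq_imp_space_eq[OF assms(1)] sets_eq_imp_space_eq[OF assms(2)] by auto
  fix A :: "'b set" assume A [measurable]: "A \<in> sets borel"
  have "f -` A \<in> sets borel"
    using measurable_sets_borel[OF f A] .
  then show "emeasure (distr (mixture t \<mu> \<nu>) borel f) A =
      ennreal (1 - t) * emeasure (distr \<mu> borel f) A + ennreal t * emeasure (distr \<nu> borel f) A"
    by (simp add: emeasure_distr emeasure_mixture sp)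
qed simp_all

lemma prob_space_mixture:
  assumes "prob_space \<mu>" "prob_space \<nu>" "sets \<mu> = sets borel" "sets \<nu> = sets borel"
    and t: "0 \<le> t" "t \<le> 1"
  shows "prob_space (mixture t \<mu> \<nu>)"
proof (rule prob_spaceI)
  have "space \<mu> = UNIV" "space \<nu> = UNIV"
    using sets_eq_imp_space_eq[OF assms(3)] sets_eq_imp_space_eq[OF assms(4)] by simp_all
  then show "emeasure (mixture t \<mu> \<nu>) (space (mixture t \<mu> \<nu>)) = 1"
    using assms prob_space.emeasure_space_1[of \<mu>] prob_space.emeasure_space_1[of \<nu>]
    by (simp add: emeasure_mixture ennreal_plus[symmetric] del: ennreal_plus)
qed

section \<open>Second moments, couplings and the W2 distance along a segment\<close>

lemma P2_D:
  assumes "\<mu> \<in> P2"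
  shows "prob_space \<mu>" "sets \<mu> = sets borel" "integrable \<mu> (\<lambda>x. (norm x)\<^sup>2)"
  using assms by (auto simp: P2_def)

lemma mixture_P2:
  assumes "\<mu> \<in> P2" "\<nu> \<in> P2" "0 \<le> t" "t \<le> 1"
  shows "mixture t \<mu> \<nu> \<in> P2"
  using assms by (auto simp: P2_def intro!: prob_space_mixture integrable_mixture)

definition second_moment :: "'a::euclidean_space measure \<Rightarrow> real" where
  "second_moment \<mu> = (\<integral>x. (norm x)\<^sup>2 \<partial>\<mu>)"

lemma second_moment_nonneg: "0 \<le> second_moment \<mu>"
  by (simp add: second_moment_def)

lemma second_moment_mixture_le:
  assumes "\<mu> \<in> P2" "\<nu> \<in> P2" "0 \<le> t" "t \<le> 1"
  shows "second_moment (mixture t \<mu> \<nu>) \<le> second_moment \<mu> + second_moment \<nu>"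
  using assms P2_D[OF assms(1)] P2_D[OF assms(2)]
    second_moment_nonneg[of \<mu>] second_moment_nonneg[of \<nu>]
  by (simp add: second_moment_def integral_mixture add_mono mult_left_le_one_le)

lemma W2_le:
  assumes "\<pi> \<in> couplings \<mu> \<nu>" "(\<integral>\<^sup>+z. ennreal ((dist (fst z) (snd z))\<^sup>2) \<partial>\<pi>) \<le> ennreal c" "0 \<le> c"
  shows "W2 \<mu> \<nu> \<le> sqrt c"
proof -
  have "(INF \<pi>\<in>couplings \<mu> \<nu>. \<integral>\<^sup>+ z. ennreal ((dist (fst z) (snd z))\<^sup>2) \<partial>\<pi>) \<le> ennreal c"
    using assms by (meson INF_lower2)
  then show ?thesis
    unfolding W2_def using assms(3) by (simp add: enn2real_leI)
qed

text \<open>The bound \<open>|x - y|^2 \<le> 2 |x|^2 + 2 |y|^2\<close> splits the cost into two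
  terms, each depending on one coordinate and hence evaluated by a marginal.\<close>

lemma nn_integral_dist_coupling_le:
  assumes \<pi>: "\<pi> \<in> couplings \<mu> \<nu>" and P: "\<mu> \<in> P2" "\<nu> \<in> P2"
  shows "(\<integral>\<^sup>+z. ennreal ((dist (fst z) (snd z))\<^sup>2) \<partial>\<pi>)
    \<le> ennreal (2 * (second_moment \<mu> + second_moment \<nu>))"
proof -
  have [measurable_cong, simp]: "sets \<pi> = sets borel"
    and \<mu>: "distr \<pi> borel fst = \<mu>" and \<nu>: "distr \<pi> borel snd = \<nu>"
    using \<pi> by (auto simp: couplings_def)
  have [measurable]: "fst \<in> measurable \<pi> borel" "snd \<in> measurable \<pi> borel"
    by (simp_all add: measurable_cong_sets[of \<pi> borel] borel_measurable_continuous_onI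
        continuous_on_fst continuous_on_snd)
  have d: "(dist x y)\<^sup>2 \<le> 2 * (norm x)\<^sup>2 + 2 * (norm y)\<^sup>2" for x y :: 'a
  proof -
    have "(dist x y)\<^sup>2 \<le> (norm x + norm y)\<^sup>2"
      by (simp add: dist_norm norm_triangle_ineq4 power_mono)
    also have "\<dots> \<le> 2 * (norm x)\<^sup>2 + 2 * (norm y)\<^sup>2"
      using sum_squares_bound[of "norm x" "norm y"] by (simp add: power2_sum)
    finally show ?thesis .
  qed
  have sm: "(\<integral>\<^sup>+x. ennreal (2 * (norm x)\<^sup>2) \<partial>\<rho>) = ennreal (2 * second_moment \<rho>)" if "\<rho> \<in> P2" for \<rho> :: "'a measure"
    using P2_D[OF that] by (subst nn_integral_eq_integral) (auto simp: second_moment_def)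
  have "(\<integral>\<^sup>+z. ennreal ((dist (fst z) (snd z))\<^sup>2) \<partial>\<pi>)
      \<le> (\<integral>\<^sup>+z. ennreal (2 * (norm (fst z))\<^sup>2) + ennreal (2 * (norm (snd z))\<^sup>2) \<partial>\<pi>)"
    using d by (intro nn_integral_mono) (simp add: ennreal_plus[symmetric] ennreal_leI del: ennreal_plus)
  also have "\<dots> = (\<integral>\<^sup>+z. ennreal (2 * (norm (fst z))\<^sup>2) \<partial>\<pi>) + (\<integral>\<^sup>+z. ennreal (2 * (norm (snd z))\<^sup>2) \<partial>\<pi>)"
    by (rule nn_integral_add) measurable
  also have "(\<integral>\<^sup>+z. ennreal (2 * (norm (fst z))\<^sup>2) \<partial>\<pi>) = (\<integral>\<^sup>+x. ennreal (2 * (norm x)\<^sup>2) \<partial>\<mu>)"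
    by (subst \<mu>[symmetric], subst nn_integral_distr) auto
  also have "(\<integral>\<^sup>+z. ennreal (2 * (norm (snd z))\<^sup>2) \<partial>\<pi>) = (\<integral>\<^sup>+x. ennreal (2 * (norm x)\<^sup>2) \<partial>\<nu>)"
    by (subst \<nu>[symmetric], subst nn_integral_distr) auto
  finally show ?thesis
    using P by (simp add: sm second_moment_nonneg ennreal_plus[symmetric] del: ennreal_plus)
qed

lemma pair_measure_couplings:
  assumes "prob_space \<mu>" "prob_space \<nu>" "sets \<mu> = sets borel" "sets \<nu> = sets borel"
  shows "\<nu> \<Otimes>\<^sub>M \<mu> \<in> couplings \<nu> \<mu>"
proof -
  interpret \<mu>: prob_space \<mu> by fact
  interpret \<nu>: prob_space \<nu> by fact
  interpret pair_prob_space \<nu> \<mu> ..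
  have sp: "space \<mu> = UNIV" "space \<nu> = UNIV"
    using sets_eq_imp_space_eq[OF assms(3)] sets_eq_imp_space_eq[OF assms(4)] by simp_all
  \<comment> \<open>By second countability the product of the two Borel sigma-algebras is the Borel
    sigma-algebra of the product space, as \<open>couplings\<close> requires.\<close>
  have s: "sets (\<nu> \<Otimes>\<^sub>M \<mu>) = sets borel"
    using assms by (simp add: borel_prod[symmetric] cong: sets_pair_measure_cong)
  have m: "fst \<in> measurable (\<nu> \<Otimes>\<^sub>M \<mu>) borel" "snd \<in> measurable (\<nu> \<Otimes>\<^sub>M \<mu>) borel"
    by (simp_all add: measurable_cong_sets[OF s] borel_measurable_continuous_onI
        continuous_on_fst continuous_on_snd)
  have "distr (\<nu> \<Otimes>\<^sub>M \<mu>) borel fst = \<nu>"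
  proof (rule measure_eqI)
    fix A assume "A \<in> sets (distr (\<nu> \<Otimes>\<^sub>M \<mu>) borel fst)"
    then have A: "A \<in> sets borel" by simp
    have "fst -` A \<inter> space (\<nu> \<Otimes>\<^sub>M \<mu>) = A \<times> space \<mu>"
      by (auto simp: space_pair_measure sp)
    then show "emeasure (distr (\<nu> \<Otimes>\<^sub>M \<mu>) borel fst) A = emeasure \<nu> A"
      using A m assms(3,4) \<mu>.emeasure_pair_measure_Times[of A \<nu> "space \<mu>"] sets.top[of \<mu>]
      by (simp add: emeasure_distr \<mu>.emeasure_space_1)
  qed (use assms in simp)
  moreover have "distr (\<nu> \<Otimes>\<^sub>M \<mu>) borel snd = \<mu>"
  proof (rule measure_eqI)
    fix A assume "A \<in> sets (distr (\<nu> \<Otimes>\<^sub>M \<mu>) borel snd)"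
    then have A: "A \<in> sets borel" by simp
    have "snd -` A \<inter> space (\<nu> \<Otimes>\<^sub>M \<mu>) = space \<nu> \<times> A"
      by (auto simp: space_pair_measure sp)
    then show "emeasure (distr (\<nu> \<Otimes>\<^sub>M \<mu>) borel snd) A = emeasure \<mu> A"
      using A m assms(3,4) \<mu>.emeasure_pair_measure_Times[of "space \<nu>" \<nu> A] sets.top[of \<nu>]
      by (simp add: emeasure_distr \<nu>.emeasure_space_1)
  qed (use assms in simp)
  ultimately show ?thesis
    using s P.prob_space_axioms by (simp add: couplings_def)
qed

text \<open>The fraction \<open>1 - r\<close> of the mass stays in place, coupled on the diagonal by
  \<open>\<Delta>\<close>; the fraction \<open>r\<close> is moved by the product coupling
  \<open>\<kappa>\<close>. Only the second part costs anything, so the cost is linear in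
  \<open>r\<close>.\<close>

lemma W2_mixture_le:
  assumes P: "\<mu> \<in> P2" "\<nu> \<in> P2" and r: "0 \<le> r" "r \<le> 1"
  shows "W2 (mixture r \<mu> \<nu>) \<mu> \<le> sqrt (r * (2 * (second_moment \<nu> + second_moment \<mu>)))"
proof -
  note [simp] = P2_D(2)[OF P(1)] P2_D(2)[OF P(2)]
  have \<mu>m: "measurable \<mu> N = measurable borel N" for N :: "'b measure"
    by (rule measurable_cong_sets) simp_all
  define \<Delta> where "\<Delta> = distr \<mu> borel (\<lambda>x. (x, x))"
  have diag: "(\<lambda>x. (x, x)) \<in> borel_measurable (borel :: 'a measure)"
    by (intro borel_measurable_continuous_onI continuous_intros)
  have fs: "fst \<in> borel_measurable (borel :: ('a \<times> 'a) measure)" "snd \<in> borel_measurable (borel :: ('a \<times> 'a) measure)"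
    by (simp_all add: borel_measurable_continuous_onI continuous_on_fst continuous_on_snd)
  have \<Delta>s: "sets \<Delta> = sets borel" by (simp add: \<Delta>_def)
  have id: "distr \<mu> borel (\<lambda>x. x) = \<mu>"
    by (rule distr_id2) simp
  have \<Delta>: "distr \<Delta> borel fst = \<mu>" "distr \<Delta> borel snd = \<mu>"
    using diag fs by (simp_all add: \<Delta>_def distr_distr \<mu>m comp_def id)
  have "prob_space \<Delta>"
    unfolding \<Delta>_def using P2_D(1)[OF P(1)] diag by (intro prob_space.prob_space_distr) (auto simp: \<mu>m)
  define \<kappa> where "\<kappa> = \<nu> \<Otimes>\<^sub>M \<mu>"
  have \<kappa>: "\<kappa> \<in> couplings \<nu> \<mu>"
    unfolding \<kappa>_def using P by (intro pair_measure_couplings) (auto dest: P2_D)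
  then have \<kappa>s: "sets \<kappa> = sets borel" and \<kappa>p: "prob_space \<kappa>"
    and \<kappa>d: "distr \<kappa> borel fst = \<nu>" "distr \<kappa> borel snd = \<mu>"
    by (auto simp: couplings_def)
  \<comment> \<open>Both couplings have second marginal \<mu>, so this is the second marginal of
    their mixture.\<close>
  have "mixture r \<mu> \<mu> = \<mu>"
    by (rule mixture_eqI)
      (use r in \<open>auto simp: distrib_right[symmetric] ennreal_plus[symmetric] simp del: ennreal_plus\<close>)
  then have "mixture r \<Delta> \<kappa> \<in> couplings (mixture r \<mu> \<nu>) \<mu>"
    using \<open>prob_space \<Delta>\<close> \<kappa>p \<Delta>s \<kappa>s r fs
    by (simp add: couplings_def prob_space_mixture distr_mixture \<Delta> \<kappa>d)
  moreover have "(\<integral>\<^sup>+z. ennreal ((dist (fst z) (snd z))\<^sup>2) \<partial>mixture r \<Delta> \<kappa>)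
      \<le> ennreal (r * (2 * (second_moment \<nu> + second_moment \<mu>)))"
  proof -
    have m: "(\<lambda>z :: 'a \<times> 'a. ennreal ((dist (fst z) (snd z))\<^sup>2)) \<in> borel_measurable borel"
      by (intro measurable_compose[OF _ measurable_ennreal] borel_measurable_continuous_onI
          continuous_intros)
    have "(\<integral>\<^sup>+z. ennreal ((dist (fst z) (snd z))\<^sup>2) \<partial>\<Delta>) = 0"
      unfolding \<Delta>_def using diag m by (subst nn_integral_distr) (auto simp: \<mu>m)
    then show ?thesis
      using nn_integral_dist_coupling_le[OF \<kappa> P(2,1)] r second_moment_nonneg[of \<mu>] second_moment_nonneg[of \<nu>]
      by (simp add: nn_integral_mixture \<Delta>s \<kappa>s m ennreal_mult[of r] mult_left_mono)
  qed
  ultimately show ?thesis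
    using r second_moment_nonneg[of \<mu>] second_moment_nonneg[of \<nu>] by (intro W2_le) auto
qed

lemma W2_nonneg: "0 \<le> W2 \<mu> \<nu>"
  by (simp add: W2_def)

lemma W2_self:
  assumes "\<mu> \<in> P2"
  shows "W2 \<mu> \<mu> = 0"
  using W2_mixture_le[OF assms assms, of 0] W2_nonneg[of \<mu> \<mu>] P2_D[OF assms] by simp

lemma W2_le_second_moments:
  assumes "\<mu> \<in> P2" "\<nu> \<in> P2"
  shows "W2 \<nu> \<mu> \<le> sqrt (2 * (second_moment \<nu> + second_moment \<mu>))"
  using W2_mixture_le[OF assms, of 1] P2_D[OF assms(1)] P2_D[OF assms(2)] by simp

lemma W2_bounded_mixtures:
  assumes "\<mu> \<in> P2" "\<nu> \<in> P2"
  shows "W2_bounded ((\<lambda>t. mixture t \<mu> \<nu>) ` {0..1})"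
proof -
  \<comment> \<open>The 4 is the 2 of \<open>W2_le_second_moments\<close> times the number of second
    moments there, each at most that of \<mu> plus that of \<nu>.\<close>
  have "W2 (mixture s \<mu> \<nu>) (mixture t \<mu> \<nu>) \<le> sqrt (4 * (second_moment \<mu> + second_moment \<nu>))"
    if "s \<in> {0..1}" "t \<in> {0..1}" for s t
  proof -
    have "second_moment (mixture t \<mu> \<nu>) + second_moment (mixture s \<mu> \<nu>)
        \<le> 2 * (second_moment \<mu> + second_moment \<nu>)"
      using second_moment_mixture_le[OF assms, of s] second_moment_mixture_le[OF assms, of t] that
      by auto
    then show ?thesis
      using that assms
      by (intro order.trans[OF W2_le_second_moments]) (auto intro: mixture_P2)
  qed
  then show ?thesis
    unfolding W2_bounded_def by blast
qed

text \<open>Each side of \<open>t\<close> is reached from \<open>mixture t \<mu> \<nu>\<close> by mixing in \<open>\<nu>\<close> or \<open>\<mu>\<close>, so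
  the distance bound for mixtures with a fixed base point applies on both sides.\<close>

lemma tendsto_W2_mixture:
  assumes P: "\<mu> \<in> P2" "\<nu> \<in> P2" and t: "t \<in> {0..1}"
  shows "((\<lambda>s. W2 (mixture s \<mu> \<nu>) (mixture t \<mu> \<nu>)) \<longlongrightarrow> 0) (at t within {0..1})"
proof -
  note [simp] = P2_D(2)[OF P(1)] P2_D(2)[OF P(2)]
  define \<rho> where "\<rho> = mixture t \<mu> \<nu>"
  have \<rho>: "\<rho> \<in> P2" using P t by (auto simp: \<rho>_def intro: mixture_P2)
  define c where "c = 2 * (second_moment \<mu> + second_moment \<nu> + second_moment \<rho>)"
  have c: "0 \<le> c" "2 * (second_moment \<nu> + second_moment \<rho>) \<le> c"
    "2 * (second_moment \<mu> + second_moment \<rho>) \<le> c"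
    using second_moment_nonneg[of \<mu>] second_moment_nonneg[of \<nu>] second_moment_nonneg[of \<rho>]
    by (auto simp: c_def)
  \<comment> \<open>The mixing weight is \<open>(s - t) / (1 - t)\<close> to the right of
    \<open>t\<close> and \<open>(t - s) / t\<close> to the left; the sum of reciprocals covers both.
    At \<open>t = 0\<close> or \<open>t = 1\<close> one reciprocal is 0 by the convention for
    division by zero, and the corresponding side of \<open>t\<close> contains no
    \<open>s\<close>.\<close>
  define b where "b s = sqrt (\<bar>s - t\<bar> * (c * (1 / t + 1 / (1 - t))))" for s
  have bound: "W2 (mixture s \<mu> \<nu>) \<rho> \<le> b s" if s: "s \<in> {0..1}" "s \<noteq> t" for s
  proof -
    obtain r \<sigma> where r: "0 \<le> r" "r \<le> 1" "r \<le> \<bar>s - t\<bar> * (1 / t + 1 / (1 - t))"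
      and \<sigma>: "\<sigma> \<in> {\<mu>, \<nu>}" and eq: "mixture s \<mu> \<nu> = mixture r \<rho> \<sigma>"
    proof (cases "t < s")
      case True
      show ?thesis
      proof (rule that[of "(s - t) / (1 - t)" \<nu>])
        show "0 \<le> (s - t) / (1 - t)" "(s - t) / (1 - t) \<le> 1"
          using True s by auto
        then show "mixture s \<mu> \<nu> = mixture ((s - t) / (1 - t)) \<rho> \<nu>"
          unfolding \<rho>_def using True s t by (subst mixture_mixture_right) auto
        show "(s - t) / (1 - t) \<le> \<bar>s - t\<bar> * (1 / t + 1 / (1 - t))"
          using True t by (simp add: distrib_left)
      qed simp
    next
      case False
      then have st: "s < t" using s by auto
      show ?thesis
      proof (rule that[of "(t - s) / t" \<mu>])
        show r: "0 \<le> (t - s) / t" "(t - s) / t \<le> 1"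
          using st s by auto
        have "mixture ((t - s) / t) \<rho> \<mu> = mixture (1 - (t - s) / t) \<mu> (mixture t \<mu> \<nu>)"
          unfolding \<rho>_def by (rule mixture_commute) simp_all
        also have "\<dots> = mixture ((1 - (t - s) / t) * t) \<mu> \<nu>"
          using r t by (intro mixture_mixture_left) auto
        also have "(1 - (t - s) / t) * t = s"
          using st s by (auto simp: field_simps)
        finally show "mixture s \<mu> \<nu> = mixture ((t - s) / t) \<rho> \<mu>" ..
        show "(t - s) / t \<le> \<bar>s - t\<bar> * (1 / t + 1 / (1 - t))"
          using st t by (simp add: distrib_left)
      qed simp
    qed
    have "W2 (mixture s \<mu> \<nu>) \<rho> \<le> sqrt (r * (2 * (second_moment \<sigma> + second_moment \<rho>)))"
      unfolding eq using P \<rho> \<sigma> r by (intro W2_mixture_le) auto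
    also have "r * (2 * (second_moment \<sigma> + second_moment \<rho>)) \<le> (\<bar>s - t\<bar> * (1 / t + 1 / (1 - t))) * c"
      using r \<sigma> c second_moment_nonneg[of \<sigma>] second_moment_nonneg[of \<rho>] by (intro mult_mono) auto
    finally show ?thesis
      by (simp add: b_def mult_ac)
  qed
  have "(b \<longlongrightarrow> b t) (at t within {0..1})"
    unfolding b_def by (intro tendsto_intros)
  then have lim: "(b \<longlongrightarrow> 0) (at t within {0..1})"
    by (simp add: b_def)
  have upper: "\<forall>\<^sub>F s in at t within {0..1}. W2 (mixture s \<mu> \<nu>) \<rho> \<le> b s"
    using bound by (auto simp: eventually_at_filter)
  have lower: "\<forall>\<^sub>F s in at t within {0..1}. 0 \<le> W2 (mixture s \<mu> \<nu>) \<rho>"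
    by (simp add: W2_nonneg)
  show ?thesis
    using tendsto_sandwich[OF lower upper tendsto_const lim] by (simp add: \<rho>_def)
qed

text \<open>Serves twice: for the functional itself, and for \<open>D\<close> at a fixed point
  \<open>x\<close> as a function of the measure.\<close>

lemma continuous_on_mixture:
  assumes "W2_continuous \<Phi>" and P: "\<mu> \<in> P2" "\<nu> \<in> P2"
  shows "continuous_on {0..1} (\<lambda>t. \<Phi> (mixture t \<mu> \<nu>))"
  unfolding continuous_on_def
proof
  fix t :: real assume t: "t \<in> {0..1}"
  show "((\<lambda>t. \<Phi> (mixture t \<mu> \<nu>)) \<longlongrightarrow> \<Phi> (mixture t \<mu> \<nu>)) (at t within {0..1})"
  proof (rule tendstoI)
    fix e :: real assume "0 < e"
    then obtain r where r: "r > 0"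
      "\<And>\<rho>. \<rho> \<in> P2 \<Longrightarrow> W2 \<rho> (mixture t \<mu> \<nu>) < r \<Longrightarrow> \<bar>\<Phi> \<rho> - \<Phi> (mixture t \<mu> \<nu>)\<bar> < e"
      using assms(1) t mixture_P2[OF P, of t] unfolding W2_continuous_def by fastforce
    have "\<forall>\<^sub>F s in at t within {0..1}. W2 (mixture s \<mu> \<nu>) (mixture t \<mu> \<nu>) < r"
      using order_tendstoD(2)[OF tendsto_W2_mixture[OF P t] r(1)] .
    moreover have "\<forall>\<^sub>F s in at t within {0..1}. s \<in> {0..1}"
      by (simp add: eventually_at_filter)
    ultimately show "\<forall>\<^sub>F s in at t within {0..1}. dist (\<Phi> (mixture s \<mu> \<nu>)) (\<Phi> (mixture t \<mu> \<nu>)) < e"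
      by eventually_elim (use P in \<open>auto simp: dist_real_def intro!: r mixture_P2\<close>)
  qed
qed


section \<open>Convex functions and the convex order on P2\<close>

lemma convex_on_UNIV_borel_measurable:
  fixes \<phi> :: "'a::euclidean_space \<Rightarrow> real"
  assumes "convex_on UNIV \<phi>"
  shows "\<phi> \<in> borel_measurable borel"
  using convex_on_continuous[OF open_UNIV assms] by (rule borel_measurable_continuous_onI)

text \<open>The origin is a convex combination of \<open>x\<close> and the unit vector opposite to it, and the
  convex function is bounded on the unit sphere by continuity.\<close>

lemma convex_on_UNIV_lower_bound:
  fixes \<phi> :: "'a::euclidean_space \<Rightarrow> real"
  assumes \<phi>: "convex_on UNIV \<phi>"
  shows "\<exists>C. \<forall>x. - \<phi> x \<le> C * (1 + (norm x)\<^sup>2)"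
proof -
  have "continuous_on (cball 0 1) \<phi>"
    using convex_on_continuous[OF open_UNIV \<phi>] continuous_on_subset by blast
  then have "bounded (\<phi> ` cball 0 1)"
    by (intro compact_imp_bounded compact_continuous_image) auto
  then obtain M where "\<forall>y\<in>cball 0 1. \<bar>\<phi> y\<bar> \<le> M"
    unfolding bounded_iff by auto
  then have M: "\<bar>\<phi> y\<bar> \<le> M" if "norm y \<le> 1" for y
    using that by auto
  have "0 \<le> M" using M[of 0] by simp
  \<comment> \<open>The factor 4 is generous: the argument yields \<open>(1 + 2 * r) * M\<close>,
    and \<open>2 * r\<close> is at most \<open>1 + r\<^sup>2\<close>.\<close>
  have "- \<phi> x \<le> (4 * M) * (1 + (norm x)\<^sup>2)" for x
  proof -
    define r where "r = norm x"
    have r: "0 \<le> r" by (simp add: r_def)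
    \<comment> \<open>For \<open>x = 0\<close> division by zero gives \<open>y = 0\<close>, so the
      norm bound and the convex combination below remain valid.\<close>
    define y where "y = (- 1 / r) *\<^sub>R x"
    have y: "norm y \<le> 1" by (simp add: y_def r_def)
    have "0 = (1 / (1 + r)) *\<^sub>R x + (r / (1 + r)) *\<^sub>R y"
      by (cases "x = 0") (auto simp: y_def r_def)
    then have "\<phi> 0 = \<phi> ((1 / (1 + r)) *\<^sub>R x + (r / (1 + r)) *\<^sub>R y)"
      by simp
    also have "\<dots> \<le> 1 / (1 + r) * \<phi> x + r / (1 + r) * \<phi> y"
      using r by (intro \<phi>[unfolded convex_on_def, THEN conjunct2, rule_format]) (auto simp: add_divide_distrib[symmetric])
    finally have "(1 + r) * \<phi> 0 \<le> (1 + r) * (1 / (1 + r) * \<phi> x + r / (1 + r) * \<phi> y)"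
      using r by (intro mult_left_mono) auto
    also have "\<dots> = \<phi> x + r * \<phi> y"
      using r by (simp add: distrib_left)
    finally have "- \<phi> x \<le> r * \<phi> y + (1 + r) * (- \<phi> 0)" by simp
    also have "\<dots> \<le> r * M + (1 + r) * M"
      using r M[OF y] M[of 0] by (intro add_mono mult_left_mono) auto
    also have "\<dots> = (1 + 2 * r) * M" by (simp add: algebra_simps)
    also have "\<dots> \<le> (4 * (1 + r\<^sup>2)) * M"
    proof (rule mult_right_mono)
      have "2 * r \<le> 1 + r\<^sup>2"
        using sum_squares_bound[of r 1] by simp
      then show "1 + 2 * r \<le> 4 * (1 + r\<^sup>2)"
        unfolding distrib_left by (smt (verit) zero_le_power2)
    qed fact
    finally show ?thesis by (simp add: r_def mult_ac)
  qed
  then show ?thesis by blast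
qed

lemma P2_nn_integral_quadratic:
  assumes "\<mu> \<in> P2"
  shows "(\<integral>\<^sup>+x. ennreal (C * (1 + (norm x)\<^sup>2)) \<partial>\<mu>) < \<top>"
proof -
  interpret prob_space \<mu> using P2_D(1)[OF assms] .
  have "integrable \<mu> (\<lambda>x. C * (1 + (norm x)\<^sup>2))"
    using P2_D(3)[OF assms] by simp
  then show ?thesis
    unfolding real_integrable_def less_top[symmetric] infinity_ennreal_def by blast
qed

text \<open>The negative part is dominated by a quadratic function, which the second moment makes
  integrable.\<close>

lemma P2_nn_integral_convex_neg_finite:
  fixes \<phi> :: "'a::euclidean_space \<Rightarrow> real"
  assumes "\<mu> \<in> P2" "convex_on UNIV \<phi>"
  shows "(\<integral>\<^sup>+x. ennreal (- \<phi> x) \<partial>\<mu>) < \<top>"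
proof -
  obtain C where "\<And>x. - \<phi> x \<le> C * (1 + (norm x)\<^sup>2)"
    using convex_on_UNIV_lower_bound[OF assms(2)] by blast
  then have "(\<integral>\<^sup>+x. ennreal (- \<phi> x) \<partial>\<mu>) \<le> (\<integral>\<^sup>+x. ennreal (C * (1 + (norm x)\<^sup>2)) \<partial>\<mu>)"
    by (intro nn_integral_mono ennreal_leI)
  then show ?thesis
    using P2_nn_integral_quadratic[OF assms(1)] by (rule le_less_trans)
qed

text \<open>With finite \<open>b\<close> and \<open>d\<close> no difference of two infinities
  arises, so cross-addition is faithful even when \<open>a\<close> or \<open>c\<close> is \<top>, as
  can happen for the positive part of a convex function.\<close>

lemma ereal_diff_le_iff_cross_add:
  fixes a b c d :: ennreal
  assumes "b < \<top>" "d < \<top>"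
  shows "enn2ereal a - enn2ereal b \<le> enn2ereal c - enn2ereal d \<longleftrightarrow> a + d \<le> c + b"
  using assms
  by (cases a; cases b; cases c; cases d)
    (auto simp: enn2ereal_ennreal ennreal_plus[symmetric] ennreal_le_iff top_unique simp del: ennreal_plus)

text \<open>Moving the finite negative parts to the other side makes the order a system of linear
  inequalities in \<^typ>\<open>ennreal\<close>.\<close>

lemma convex_order_iff:
  assumes "\<mu> \<in> P2" "\<nu> \<in> P2"
  shows "\<mu> \<preceq>cv \<nu> \<longleftrightarrow> (\<forall>\<phi>. convex_on UNIV \<phi> \<longrightarrow>
    (\<integral>\<^sup>+x. ennreal (\<phi> x) \<partial>\<mu>) + (\<integral>\<^sup>+x. ennreal (- \<phi> x) \<partial>\<nu>) \<le>
    (\<integral>\<^sup>+x. ennreal (\<phi> x) \<partial>\<nu>) + (\<integral>\<^sup>+x. ennreal (- \<phi> x) \<partial>\<mu>))"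
  unfolding convex_order_def ext_integral_def
  using assms by (simp add: ereal_diff_le_iff_cross_add P2_nn_integral_convex_neg_finite)

text \<open>Integrals are affine along the segment, so the increment from \<open>s\<close> to
  \<open>t\<close> is \<open>t - s\<close> times the one from \<mu> to \<nu>.\<close>

lemma convex_order_mixture_mono:
  assumes P: "\<mu> \<in> P2" "\<nu> \<in> P2" and cv: "\<mu> \<preceq>cv \<nu>" and st: "0 \<le> s" "s \<le> t" "t \<le> 1"
  shows "mixture s \<mu> \<nu> \<preceq>cv mixture t \<mu> \<nu>"
proof -
  have P': "mixture s \<mu> \<nu> \<in> P2" "mixture t \<mu> \<nu> \<in> P2"
    using P st by (auto intro: mixture_P2)
  show ?thesis
    unfolding convex_order_iff[OF P']
  proof (intro allI impI)
    fix \<phi> :: "'a \<Rightarrow> real" assume \<phi>: "convex_on UNIV \<phi>"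
    note [measurable] = convex_on_UNIV_borel_measurable[OF \<phi>]
    let ?p = "\<lambda>\<mu>. \<integral>\<^sup>+x. ennreal (\<phi> x) \<partial>\<mu>" and ?n = "\<lambda>\<mu>. \<integral>\<^sup>+x. ennreal (- \<phi> x) \<partial>\<mu>"
    have pn: "?p \<mu> + ?n \<nu> \<le> ?p \<nu> + ?n \<mu>"
      using cv \<phi> by (simp add: convex_order_iff[OF P])
    \<comment> \<open>The pieces \<open>1 - t\<close>, \<open>t - s\<close> and \<open>s\<close> of
      the unit mass express all four weights by sums. The common remainder \<open>?R\<close> then
      appears on both sides, which replaces a subtraction in \<open>ennreal\<close>.\<close>
    define u where "u = ennreal (1 - t)"
    define d where "d = ennreal (t - s)"
    define v where "v = ennreal s"
    have w: "ennreal (1 - s) = u + d" "ennreal t = d + v"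
      using st by (simp_all add: u_def d_def v_def ennreal_plus[symmetric] del: ennreal_plus)
    have mix: "?p (mixture s \<mu> \<nu>) = (u + d) * ?p \<mu> + v * ?p \<nu>"
      "?n (mixture s \<mu> \<nu>) = (u + d) * ?n \<mu> + v * ?n \<nu>"
      "?p (mixture t \<mu> \<nu>) = u * ?p \<mu> + (d + v) * ?p \<nu>"
      "?n (mixture t \<mu> \<nu>) = u * ?n \<mu> + (d + v) * ?n \<nu>"
      using P2_D(2)[OF P(1)] P2_D(2)[OF P(2)]
      by (simp_all add: nn_integral_mixture w u_def[symmetric] v_def[symmetric])
    let ?R = "u * ?p \<mu> + v * ?p \<nu> + (u * ?n \<mu> + v * ?n \<nu>)"
    have "?p (mixture s \<mu> \<nu>) + ?n (mixture t \<mu> \<nu>) = d * (?p \<mu> + ?n \<nu>) + ?R"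
      by (simp add: mix algebra_simps)
    also have "\<dots> \<le> d * (?p \<nu> + ?n \<mu>) + ?R"
      using pn by (intro add_right_mono mult_left_mono) auto
    also have "\<dots> = ?p (mixture t \<mu> \<nu>) + ?n (mixture s \<mu> \<nu>)"
      by (simp add: mix algebra_simps)
    finally show "?p (mixture s \<mu> \<nu>) + ?n (mixture t \<mu> \<nu>) \<le> ?p (mixture t \<mu> \<nu>) + ?n (mixture s \<mu> \<nu>)" .
  qed
qed

lemma convex_order_mixture:
  assumes P: "\<mu> \<in> P2" "\<nu> \<in> P2" and "\<mu> \<preceq>cv \<nu>" "0 \<le> t" "t \<le> 1"
  shows "\<mu> \<preceq>cv mixture t \<mu> \<nu>" "mixture t \<mu> \<nu> \<preceq>cv \<nu>"
  using convex_order_mixture_mono[OF assms(1-3), of 0 t] convex_order_mixture_mono[OF assms(1-3), of t 1]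
    assms P2_D(2)[OF P(1)] P2_D(2)[OF P(2)] by auto

text \<open>For integrable \<phi> both parts are finite, and \<open>ext_integral\<close> is the
  ordinary integral.\<close>

lemma convex_order_integral_le:
  assumes "\<mu> \<preceq>cv \<nu>" "convex_on UNIV \<phi>" "integrable \<mu> \<phi>" "integrable \<nu> \<phi>"
  shows "(\<integral>x. \<phi> x \<partial>\<mu>) \<le> (\<integral>x. \<phi> x \<partial>\<nu>)"
proof -
  have ext: "ext_integral M \<phi> = ereal (\<integral>x. \<phi> x \<partial>M)" if "integrable M \<phi>" for M
  proof -
    have "(\<integral>\<^sup>+x. ennreal (\<phi> x) \<partial>M) \<noteq> \<top>" "(\<integral>\<^sup>+x. ennreal (- \<phi> x) \<partial>M) \<noteq> \<top>"
      using that by (auto simp: real_integrable_def)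
    then show ?thesis
      unfolding ext_integral_def real_lebesgue_integral_def[OF that]
      by (cases "\<integral>\<^sup>+x. ennreal (\<phi> x) \<partial>M"; cases "\<integral>\<^sup>+x. ennreal (- \<phi> x) \<partial>M")
        (auto simp: enn2ereal_ennreal)
  qed
  show ?thesis
    using assms by (auto simp: convex_order_def ext)
qed

section \<open>Real functions with nonnegative lower right Dini derivative\<close>

text \<open>Adding a small slope \<eta> gives strict room: the last \<open>T\<close> at which
  \<open>f t - f 0 + \<eta> * t\<close> is nonnegative cannot lie before 1, since the Dini condition
  at \<open>T\<close> produces a later such point. The step \<open>\<epsilon> * (1 - t)\<close> is
  the parameter change caused by mixing in the end point with weight \<epsilon>.\<close>

lemma nondecreasing_of_lower_right_Dini_nonneg:
  fixes f :: "real \<Rightarrow> real"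
  assumes cont: "continuous_on {0..1} f"
    and Dini: "\<And>t. 0 \<le> t \<Longrightarrow> t < 1 \<Longrightarrow>
      0 \<le> Liminf (at_right 0) (\<lambda>\<epsilon>. ereal ((f (t + \<epsilon> * (1 - t)) - f t) / \<epsilon>))"
  shows "f 0 \<le> f 1"
proof (rule field_le_epsilon)
  fix \<eta> :: real assume \<eta>: "0 < \<eta>"
  define S where "S = {t \<in> {0..1}. 0 \<le> f t - f 0 + \<eta> * t}"
  have "closed S"
    unfolding S_def
    by (intro continuous_on_closed_Collect_le closed_atLeastAtMost continuous_intros cont)
  have "0 \<in> S" by (simp add: S_def)
  have bdd: "bdd_above S" by (auto simp: S_def intro!: bdd_aboveI[of _ 1])
  define T where "T = Sup S"
  have T: "T \<in> S"
    unfolding T_def using \<open>closed S\<close> \<open>0 \<in> S\<close> bdd by (intro closed_contains_Sup) auto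
  have "T = 1"
  proof (rule ccontr)
    assume "T \<noteq> 1"
    then have T1: "0 \<le> T" "T < 1" using T by (auto simp: S_def)
    \<comment> \<open>The quotient divides by \<epsilon>, not by the actual step
      \<open>\<epsilon> * (1 - T)\<close>, so the threshold \<open>- \<eta>\<close> is scaled by
      \<open>1 - T\<close>.\<close>
    have "ereal (- \<eta> * (1 - T)) < 0"
      using T1 \<eta> by (simp add: mult_neg_pos)
    then have "\<forall>\<^sub>F \<epsilon> in at_right 0. ereal (- \<eta> * (1 - T)) < ereal ((f (T + \<epsilon> * (1 - T)) - f T) / \<epsilon>)"
      using Dini[OF T1] unfolding le_Liminf_iff by blast
    moreover have "\<forall>\<^sub>F \<epsilon> in at_right 0. 0 < \<epsilon> \<and> \<epsilon> < (1 :: real)"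
      using eventually_at_right_real[OF zero_less_one] by simp
    ultimately have "\<forall>\<^sub>F \<epsilon> in at_right 0. (0 < \<epsilon> \<and> \<epsilon> < 1) \<and>
        - \<eta> * (1 - T) < (f (T + \<epsilon> * (1 - T)) - f T) / \<epsilon>"
      by eventually_elim simp
    then obtain \<epsilon> where \<epsilon>: "0 < \<epsilon>" "\<epsilon> < 1" "- \<eta> * (1 - T) < (f (T + \<epsilon> * (1 - T)) - f T) / \<epsilon>"
      using eventually_happens'[OF trivial_limit_at_right_real] by blast
    let ?t = "T + \<epsilon> * (1 - T)"
    have "\<epsilon> * (1 - T) \<le> 1 - T" "0 < \<epsilon> * (1 - T)"
      using \<epsilon> T1 by (auto simp: mult_left_le_one_le)
    moreover have "- \<eta> * (\<epsilon> * (1 - T)) \<le> f ?t - f T"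
      using \<epsilon> by (simp add: pos_less_divide_eq mult_ac)
    ultimately have "?t \<in> S" "T < ?t"
      using T T1 by (auto simp: S_def algebra_simps)
    then show False
      using cSup_upper[OF _ bdd, of ?t] by (simp add: T_def)
  qed
  then show "f 0 \<le> f 1 + \<eta>"
    using T by (simp add: S_def)
qed

section \<open>Regularity of the linear functional derivative along segments\<close>

lemma jointly_continuous_W2_continuous:
  assumes "jointly_continuous D"
  shows "W2_continuous (\<lambda>\<mu>. D \<mu> x)"
  using assms unfolding jointly_continuous_def W2_continuous_def by (metis dist_self)

lemma jointly_continuous_borel_measurable:
  assumes D: "jointly_continuous D" and \<mu>: "\<mu> \<in> P2"
  shows "D \<mu> \<in> borel_measurable borel"
proof (rule borel_measurable_continuous_onI)
  show "continuous_on UNIV (D \<mu>)"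
    unfolding continuous_on_iff dist_real_def
  proof (intro ballI allI impI)
    fix x and e :: real assume "0 < e"
    then obtain r where "0 < r"
      "\<forall>\<nu>\<in>P2. \<forall>y. W2 \<nu> \<mu> < r \<and> dist y x < r \<longrightarrow> \<bar>D \<nu> y - D \<mu> x\<bar> < e"
      using D \<mu> unfolding jointly_continuous_def by blast
    \<comment> \<open>Joint continuity is used with the measure fixed, which is admissible since
      \<open>W2 \<mu> \<mu> = 0 < r\<close>.\<close>
    then show "\<exists>d>0. \<forall>y\<in>UNIV. dist y x < d \<longrightarrow> \<bar>D \<mu> y - D \<mu> x\<bar> < e"
      using \<mu> W2_self[OF \<mu>] by (intro exI[of _ r]) auto
  qed
qed

lemma P2_integrable_quadratic_growth:
  assumes "\<rho> \<in> P2" "f \<in> borel_measurable borel" "\<And>x. \<bar>f x\<bar> \<le> C * (1 + (norm x)\<^sup>2)"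
  shows "integrable \<rho> f"
proof -
  interpret prob_space \<rho> using P2_D(1)[OF assms(1)] .
  have "f \<in> borel_measurable \<rho>"
    using assms(2) P2_D(2)[OF assms(1)] by (simp add: measurable_cong_sets[of \<rho> borel])
  moreover have "integrable \<rho> (\<lambda>x. C * (1 + (norm x)\<^sup>2))"
    using P2_D(3)[OF assms(1)] by simp
  moreover have "AE x in \<rho>. norm (f x) \<le> norm (C * (1 + (norm x)\<^sup>2))"
    using order.trans[OF assms(3) abs_ge_self] by (intro AE_I2) (simp only: real_norm_def)
  ultimately show ?thesis
    by (metis Bochner_Integration.integrable_bound)
qed

text \<open>The segment is W2-bounded, so one constant serves all \<open>t\<close>; the resulting
  bound is the majorant for dominated convergence.\<close>

lemma locally_quadratic_growth_mixtures:
  assumes "locally_quadratic_growth D" "\<mu> \<in> P2" "\<nu> \<in> P2"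
  shows "\<exists>C. \<forall>t\<in>{0..1}. \<forall>x. \<bar>D (mixture t \<mu> \<nu>) x\<bar> \<le> C * (1 + (norm x)\<^sup>2)"
proof -
  have "(\<lambda>t. mixture t \<mu> \<nu>) ` {0..1} \<subseteq> P2"
    using assms by (auto intro: mixture_P2)
  then have "\<exists>C. \<forall>\<rho>\<in>(\<lambda>t. mixture t \<mu> \<nu>) ` {0..1}. \<forall>x. \<bar>D \<rho> x\<bar> \<le> C * (1 + (norm x)\<^sup>2)"
    using assms(1) W2_bounded_mixtures[OF assms(2,3)]
    by (simp only: locally_quadratic_growth_def)
  then show ?thesis by simp
qed

lemma linear_functional_derivative_integrable:
  assumes "linear_functional_derivative \<Phi> D" "\<mu> \<in> P2" "\<rho> \<in> P2"
  shows "integrable \<rho> (D \<mu>)"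
proof -
  have D: "jointly_continuous D" "locally_quadratic_growth D"
    using assms(1) by (auto simp: linear_functional_derivative_def)
  \<comment> \<open>The degenerate segment from \<mu> to itself yields the growth bound at the
    single measure \<mu>, read off at \<open>t = 0\<close>.\<close>
  obtain C where "\<And>t x. t \<in> {0..1} \<Longrightarrow> \<bar>D (mixture t \<mu> \<mu>) x\<bar> \<le> C * (1 + (norm x)\<^sup>2)"
    using locally_quadratic_growth_mixtures[OF D(2) assms(2) assms(2)] by blast
  from this[of 0] have "\<bar>D \<mu> x\<bar> \<le> C * (1 + (norm x)\<^sup>2)" for x
    using P2_D(2)[OF assms(2)] by simp
  then show ?thesis
    using jointly_continuous_borel_measurable[OF D(1) assms(2)] assms(3)
    by (intro P2_integrable_quadratic_growth)
qed

text \<open>Dominated convergence: the integrand converges pointwise by joint continuity, under a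
  quadratic majorant that is uniform in \<open>t\<close> and integrable for
  \<open>\<rho>\<close>.\<close>

lemma continuous_on_integral_mixture:
  assumes D: "jointly_continuous D" "locally_quadratic_growth D"
    and P: "\<mu> \<in> P2" "\<nu> \<in> P2" "\<rho> \<in> P2"
  shows "continuous_on {0..1} (\<lambda>t. \<integral>x. D (mixture t \<mu> \<nu>) x \<partial>\<rho>)"
  unfolding continuous_on_sequentially comp_def
proof (intro allI ballI impI, elim conjE)
  interpret prob_space \<rho> using P2_D(1)[OF P(3)] .
  fix u :: "nat \<Rightarrow> real" and t :: real
  assume t: "t \<in> {0..1}" and u: "\<forall>n. u n \<in> {0..1}" "u \<longlonglongrightarrow> t"
  obtain C where C: "\<And>t x. t \<in> {0..1} \<Longrightarrow> \<bar>D (mixture t \<mu> \<nu>) x\<bar> \<le> C * (1 + (norm x)\<^sup>2)"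
    using locally_quadratic_growth_mixtures[OF D(2) P(1,2)] by blast
  have meas: "D (mixture s \<mu> \<nu>) \<in> borel_measurable \<rho>" if "s \<in> {0..1}" for s
    using jointly_continuous_borel_measurable[OF D(1), of "mixture s \<mu> \<nu>"] mixture_P2[OF P(1,2), of s] that
      P2_D(2)[OF P(3)] by (simp add: measurable_cong_sets[of \<rho> borel])
  show "(\<lambda>n. \<integral>x. D (mixture (u n) \<mu> \<nu>) x \<partial>\<rho>) \<longlonglongrightarrow> (\<integral>x. D (mixture t \<mu> \<nu>) x \<partial>\<rho>)"
  proof (rule integral_dominated_convergence[where w = "\<lambda>x. C * (1 + (norm x)\<^sup>2)"])
    show "integrable \<rho> (\<lambda>x. C * (1 + (norm x)\<^sup>2))"
      using P2_D(3)[OF P(3)] by simp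
    have "(\<lambda>n. D (mixture (u n) \<mu> \<nu>) x) \<longlonglongrightarrow> D (mixture t \<mu> \<nu>) x" for x
      using continuous_on_mixture[OF jointly_continuous_W2_continuous[OF D(1)] P(1,2), of x] t u
      unfolding continuous_on_sequentially comp_def by blast
    then show "AE x in \<rho>. (\<lambda>n. D (mixture (u n) \<mu> \<nu>) x) \<longlonglongrightarrow> D (mixture t \<mu> \<nu>) x"
      by simp
  qed (use meas t u C in auto)
qed

lemma diff_integral_mixture:
  assumes "sets \<mu> = sets borel" "sets \<nu> = sets borel" "integrable \<mu> f" "integrable \<nu> f" "0 \<le> t" "t \<le> 1"
  shows "diff_integral (mixture t \<mu> \<nu>) \<mu> f = t * diff_integral \<nu> \<mu> f"
    "diff_integral \<nu> (mixture t \<mu> \<nu>) f = (1 - t) * diff_integral \<nu> \<mu> f"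
  using assms by (simp_all add: diff_integral_def integral_mixture algebra_simps)

text \<open>The segment from \<mu> to \<open>mixture \<epsilon> \<mu> \<nu>\<close> is an initial
  piece of the one to \<nu>, hence the parameter \<open>s * \<epsilon>\<close>; the factor
  \<epsilon> comes from the end point difference \<open>\<epsilon> (\<nu> - \<mu>)\<close>.\<close>

lemma linear_functional_derivative_mixture:
  assumes \<Phi>: "linear_functional_derivative \<Phi> D" and P: "\<mu> \<in> P2" "\<nu> \<in> P2"
    and \<epsilon>: "0 \<le> \<epsilon>" "\<epsilon> \<le> 1"
  shows "\<Phi> (mixture \<epsilon> \<mu> \<nu>) - \<Phi> \<mu> =
    (LINT s:{0..1}|lborel. \<epsilon> * diff_integral \<nu> \<mu> (D (mixture (s * \<epsilon>) \<mu> \<nu>)))"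
proof -
  note sets = P2_D(2)[OF P(1)] P2_D(2)[OF P(2)]
  have "\<Phi> (mixture \<epsilon> \<mu> \<nu>) - \<Phi> \<mu> =
      (LINT s:{0..1}|lborel. diff_integral (mixture \<epsilon> \<mu> \<nu>) \<mu> (D (mixture s \<mu> (mixture \<epsilon> \<mu> \<nu>))))"
    using \<Phi> P mixture_P2[OF P \<epsilon>] by (simp add: linear_functional_derivative_def)
  also have "\<dots> = (LINT s:{0..1}|lborel. \<epsilon> * diff_integral \<nu> \<mu> (D (mixture (s * \<epsilon>) \<mu> \<nu>)))"
  proof (rule set_lebesgue_integral_cong)
    show "\<forall>s. s \<in> {0..1} \<longrightarrow>
        diff_integral (mixture \<epsilon> \<mu> \<nu>) \<mu> (D (mixture s \<mu> (mixture \<epsilon> \<mu> \<nu>))) =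
        \<epsilon> * diff_integral \<nu> \<mu> (D (mixture (s * \<epsilon>) \<mu> \<nu>))"
    proof (intro allI impI)
      fix s :: real assume s: "s \<in> {0..1}"
      then have "mixture (s * \<epsilon>) \<mu> \<nu> \<in> P2"
        using \<epsilon> by (intro mixture_P2 P) (auto intro: mult_le_one)
      then show "diff_integral (mixture \<epsilon> \<mu> \<nu>) \<mu> (D (mixture s \<mu> (mixture \<epsilon> \<mu> \<nu>))) =
        \<epsilon> * diff_integral \<nu> \<mu> (D (mixture (s * \<epsilon>) \<mu> \<nu>))"
        using s sets \<epsilon> P linear_functional_derivative_integrable[OF \<Phi>]
        by (simp add: mixture_mixture_left diff_integral_mixture)
    qed
  qed simp
  finally show ?thesis .
qed

section \<open>Criteria for monotonicity in the convex order\<close>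

lemma cv_nondecreasing_iff_Liminf:
  assumes "W2_continuous \<Phi>"
  shows "cv_nondecreasing \<Phi> \<longleftrightarrow>
    (\<forall>\<mu>\<in>P2. \<forall>\<nu>\<in>P2. \<mu> \<preceq>cv \<nu> \<longrightarrow>
      Liminf (at_right 0) (\<lambda>\<epsilon>. ereal ((\<Phi> (mixture \<epsilon> \<mu> \<nu>) - \<Phi> \<mu>) / \<epsilon>)) \<ge> 0)"
    (is "_ \<longleftrightarrow> ?Dini")
proof
  assume nd: "cv_nondecreasing \<Phi>"
  show ?Dini
  proof (intro ballI impI)
    fix \<mu> \<nu> :: "'a measure" assume P: "\<mu> \<in> P2" "\<nu> \<in> P2" and cv: "\<mu> \<preceq>cv \<nu>"
    have "\<forall>\<^sub>F \<epsilon> in at_right 0. 0 < \<epsilon> \<and> \<epsilon> < (1 :: real)"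
      using eventually_at_right_real[OF zero_less_one] by simp
    then have "\<forall>\<^sub>F \<epsilon> in at_right 0. 0 \<le> ereal ((\<Phi> (mixture \<epsilon> \<mu> \<nu>) - \<Phi> \<mu>) / \<epsilon>)"
    proof eventually_elim
      case (elim \<epsilon>)
      then have "\<Phi> \<mu> \<le> \<Phi> (mixture \<epsilon> \<mu> \<nu>)"
        using nd P convex_order_mixture(1)[OF P cv, of \<epsilon>] mixture_P2[OF P, of \<epsilon>]
        by (auto simp: cv_nondecreasing_def)
      with elim show ?case by simp
    qed
    then show "0 \<le> Liminf (at_right 0) (\<lambda>\<epsilon>. ereal ((\<Phi> (mixture \<epsilon> \<mu> \<nu>) - \<Phi> \<mu>) / \<epsilon>))"
      by (rule Liminf_bounded)
  qed
next
  assume Dini: ?Dini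
  show "cv_nondecreasing \<Phi>"
    unfolding cv_nondecreasing_def
  proof (intro ballI impI)
    fix \<mu> \<nu> :: "'a measure" assume P: "\<mu> \<in> P2" "\<nu> \<in> P2" and cv: "\<mu> \<preceq>cv \<nu>"
    note sets = P2_D(2)[OF P(1)] P2_D(2)[OF P(2)]
    have "\<Phi> (mixture 0 \<mu> \<nu>) \<le> \<Phi> (mixture 1 \<mu> \<nu>)"
    proof (rule nondecreasing_of_lower_right_Dini_nonneg[OF continuous_on_mixture[OF assms P]])
      fix t :: real assume t: "0 \<le> t" "t < 1"
      have "0 \<le> Liminf (at_right 0)
          (\<lambda>\<epsilon>. ereal ((\<Phi> (mixture \<epsilon> (mixture t \<mu> \<nu>) \<nu>) - \<Phi> (mixture t \<mu> \<nu>)) / \<epsilon>))"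
        using Dini mixture_P2[OF P, of t] P(2) convex_order_mixture(2)[OF P cv, of t] t by auto
      also have "\<dots> = Liminf (at_right 0)
          (\<lambda>\<epsilon>. ereal ((\<Phi> (mixture (t + \<epsilon> * (1 - t)) \<mu> \<nu>) - \<Phi> (mixture t \<mu> \<nu>)) / \<epsilon>))"
      \<comment> \<open>The restart identity \<open>mixture_mixture_right\<close> is available for
        \<epsilon> between 0 and 1, which holds eventually as \<epsilon> tends to 0 from the
        right.\<close>
      proof (rule Liminf_eq)
        have "\<forall>\<^sub>F \<epsilon> in at_right 0. 0 < \<epsilon> \<and> \<epsilon> < (1 :: real)"
          using eventually_at_right_real[OF zero_less_one] by simp
        then show "\<forall>\<^sub>F \<epsilon> in at_right 0.
            ereal ((\<Phi> (mixture \<epsilon> (mixture t \<mu> \<nu>) \<nu>) - \<Phi> (mixture t \<mu> \<nu>)) / \<epsilon>) =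
            ereal ((\<Phi> (mixture (t + \<epsilon> * (1 - t)) \<mu> \<nu>) - \<Phi> (mixture t \<mu> \<nu>)) / \<epsilon>)"
          by eventually_elim (use t sets in \<open>simp add: mixture_mixture_right\<close>)
      qed
      finally show "0 \<le> Liminf (at_right 0)
          (\<lambda>\<epsilon>. ereal ((\<Phi> (mixture (t + \<epsilon> * (1 - t)) \<mu> \<nu>) - \<Phi> (mixture t \<mu> \<nu>)) / \<epsilon>))" .
    qed
    then show "\<Phi> \<mu> \<le> \<Phi> \<nu>" using sets by simp
  qed
qed

lemma cv_nondecreasing_imp_diff_integral_nonneg:
  assumes \<Phi>: "linear_functional_derivative \<Phi> D" and nd: "cv_nondecreasing \<Phi>"
    and P: "\<mu> \<in> P2" "\<nu> \<in> P2" and cv: "\<mu> \<preceq>cv \<nu>"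
  shows "0 \<le> diff_integral \<nu> \<mu> (D \<mu>)"
proof (rule ccontr)
  define g where "g t = diff_integral \<nu> \<mu> (D (mixture t \<mu> \<nu>))" for t
  assume "\<not> ?thesis"
  then have g0: "g 0 < 0"
    using P2_D(2)[OF P(1)] P2_D(2)[OF P(2)] by (simp add: g_def)
  have "continuous_on {0..1} g"
    unfolding g_def diff_integral_def using \<Phi> P
    by (intro continuous_intros continuous_on_integral_mixture)
      (auto simp: linear_functional_derivative_def)
  \<comment> \<open>Staying within \<open>- g 0 / 2\<close> of \<open>g 0\<close> keeps
    \<open>g\<close> below the negative value \<open>g 0 / 2\<close>, so the functional drops
    strictly along a short initial piece of the segment.\<close>
  then obtain \<delta> where "0 < \<delta>" and \<delta>: "\<And>t. t \<in> {0..1} \<Longrightarrow> dist t 0 < \<delta> \<Longrightarrow> dist (g t) (g 0) < - g 0 / 2"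
    using g0 unfolding continuous_on_iff by (metis atLeastAtMost_iff half_gt_zero_iff neg_0_less_iff_less order_refl zero_le_one)
  \<comment> \<open>The 1 keeps \<epsilon> a valid mixing weight; halving \<open>\<delta>\<close>
    puts the whole piece \<open>[0, \<epsilon>]\<close> inside the neighbourhood.\<close>
  define \<epsilon> where "\<epsilon> = min 1 (\<delta> / 2)"
  have \<epsilon>: "0 < \<epsilon>" "\<epsilon> \<le> 1" "\<epsilon> < \<delta>"
    using \<open>0 < \<delta>\<close> by (auto simp: \<epsilon>_def)
  have range: "s * \<epsilon> \<in> {0..1}" "s * \<epsilon> \<le> \<epsilon>" if "s \<in> {0..1}" for s
    using that \<epsilon> by (auto simp: mult_le_one mult_left_le_one_le)
  have neg: "g (s * \<epsilon>) \<le> g 0 / 2" if "s \<in> {0..1}" for s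
  proof -
    have "s * \<epsilon> < \<delta>"
      using range(2)[OF that] \<epsilon>(3) by (rule le_less_trans)
    then have "dist (s * \<epsilon>) 0 < \<delta>"
      using range(1)[OF that] by simp
    then have "\<bar>g (s * \<epsilon>) - g 0\<bar> < - g 0 / 2"
      using \<delta>[OF range(1)[OF that]] by (simp add: dist_real_def)
    then show ?thesis by (simp add: abs_less_iff)
  qed
  have "continuous_on {0..1} (\<lambda>s. \<epsilon> * g (s * \<epsilon>))"
    using range
    by (intro continuous_on_mult_left
        continuous_on_compose2[OF \<open>continuous_on {0..1} g\<close>, of _ "\<lambda>s. s * \<epsilon>"]
        continuous_on_mult_right continuous_on_id) auto
  then have "set_integrable lborel {0..1} (\<lambda>s. \<epsilon> * g (s * \<epsilon>))"
    by (rule borel_integrable_atLeastAtMost')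
  moreover have "set_integrable lborel {0..1} (\<lambda>s :: real. \<epsilon> * (g 0 / 2))"
    by (rule borel_integrable_atLeastAtMost') simp
  ultimately have "(LINT s:{0..1}|lborel. \<epsilon> * g (s * \<epsilon>)) \<le> (LINT s:{0..1::real}|lborel. \<epsilon> * (g 0 / 2))"
    using neg \<epsilon> by (intro set_integral_mono) (auto intro!: mult_left_mono simp del: times_divide_eq_right)
  also have "\<dots> < 0"
    using \<epsilon> g0 by (simp add: set_lebesgue_integral_def mult_pos_neg)
  finally have "\<Phi> (mixture \<epsilon> \<mu> \<nu>) < \<Phi> \<mu>"
    using linear_functional_derivative_mixture[OF \<Phi> P, of \<epsilon>] \<epsilon> by (simp add: g_def)
  moreover have "\<Phi> \<mu> \<le> \<Phi> (mixture \<epsilon> \<mu> \<nu>)"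
    using nd P convex_order_mixture(1)[OF P cv, of \<epsilon>] mixture_P2[OF P, of \<epsilon>] \<epsilon>
    by (auto simp: cv_nondecreasing_def)
  ultimately show False by simp
qed

lemma cv_nondecreasing_if_diff_integral_nonneg:
  fixes \<Phi> :: "'a::euclidean_space measure \<Rightarrow> real"
  assumes \<Phi>: "linear_functional_derivative \<Phi> D"
    and nonneg: "\<And>\<mu> \<nu>. \<mu> \<in> P2 \<Longrightarrow> \<nu> \<in> P2 \<Longrightarrow> \<mu> \<preceq>cv \<nu> \<Longrightarrow> 0 \<le> diff_integral \<nu> \<mu> (D \<mu>)"
  shows "cv_nondecreasing \<Phi>"
  unfolding cv_nondecreasing_def
proof (intro ballI impI)
  fix \<mu> \<nu> :: "'a measure" assume P: "\<mu> \<in> P2" "\<nu> \<in> P2" and cv: "\<mu> \<preceq>cv \<nu>"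
  note sets = P2_D(2)[OF P(1)] P2_D(2)[OF P(2)]
  \<comment> \<open>The hypothesis at \<open>mixture t \<mu> \<nu>\<close> carries the factor
    \<open>1 - t\<close>, which can be cancelled for \<open>t < 1\<close>; the remaining point
    \<open>t = 1\<close> is a null set for the integral.\<close>
  have "0 \<le> diff_integral \<nu> \<mu> (D (mixture t \<mu> \<nu>))" if t: "0 \<le> t" "t < 1" for t
  proof -
    have \<rho>: "mixture t \<mu> \<nu> \<in> P2" using P t by (intro mixture_P2) auto
    have "0 \<le> diff_integral \<nu> (mixture t \<mu> \<nu>) (D (mixture t \<mu> \<nu>))"
      using \<rho> P(2) convex_order_mixture(2)[OF P cv, of t] t by (intro nonneg) auto
    also have "\<dots> = (1 - t) * diff_integral \<nu> \<mu> (D (mixture t \<mu> \<nu>))"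
      using t sets P \<rho> linear_functional_derivative_integrable[OF \<Phi> \<rho>]
      by (intro diff_integral_mixture) auto
    finally show ?thesis using t by (simp add: zero_le_mult_iff)
  qed
  then have "0 \<le> indicator {0..1} t *\<^sub>R diff_integral \<nu> \<mu> (D (mixture t \<mu> \<nu>))" if "t \<noteq> 1" for t :: real
    using that by (auto simp: indicator_def)
  moreover have "AE t in lborel. t \<noteq> (1 :: real)"
    by (rule AE_lborel_singleton)
  ultimately have "0 \<le> (LINT t:{0..1}|lborel. diff_integral \<nu> \<mu> (D (mixture t \<mu> \<nu>)))"
    unfolding set_lebesgue_integral_def by (intro integral_nonneg_AE) (auto elim: eventually_mono)
  moreover have "\<Phi> \<nu> - \<Phi> \<mu> = (LINT t:{0..1}|lborel. diff_integral \<nu> \<mu> (D (mixture t \<mu> \<nu>)))"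
    using \<Phi> P by (simp add: linear_functional_derivative_def)
  ultimately show "\<Phi> \<mu> \<le> \<Phi> \<nu>" by simp
qed

text \<open>The derivative at \<mu> is itself a convex test function for the order, and it is
  integrable, so the order gives an inequality between real integrals.\<close>

lemma cv_nondecreasing_if_convex_derivative:
  fixes \<Phi> :: "'a::euclidean_space measure \<Rightarrow> real"
  assumes \<Phi>: "linear_functional_derivative \<Phi> D" and "\<And>\<mu>. \<mu> \<in> P2 \<Longrightarrow> convex_on UNIV (D \<mu>)"
  shows "cv_nondecreasing \<Phi>"
proof (rule cv_nondecreasing_if_diff_integral_nonneg[OF \<Phi>])
  fix \<mu> \<nu> :: "'a measure" assume "\<mu> \<in> P2" "\<nu> \<in> P2" "\<mu> \<preceq>cv \<nu>"
  then show "0 \<le> diff_integral \<nu> \<mu> (D \<mu>)"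
    using convex_order_integral_le[of \<mu> \<nu> "D \<mu>"] assms linear_functional_derivative_integrable[OF \<Phi>]
    by (simp add: diff_integral_def)
qed

theorem proposition2p2:
  fixes \<Phi> :: "(real ^ 'd) measure \<Rightarrow> real"
  assumes "W2_continuous \<Phi>"
  shows "(cv_nondecreasing \<Phi> \<longleftrightarrow>
      (\<forall>\<mu>\<in>P2. \<forall>\<nu>\<in>P2. \<mu> \<preceq>cv \<nu> \<longrightarrow>
        Liminf (at_right 0) (\<lambda>\<epsilon>. ereal ((\<Phi> (mixture \<epsilon> \<mu> \<nu>) - \<Phi> \<mu>) / \<epsilon>)) \<ge> 0))
    \<and> (\<forall>D. linear_functional_derivative \<Phi> D \<longrightarrow>
        (cv_nondecreasing \<Phi> \<longleftrightarrow>
          (\<forall>\<mu>\<in>P2. \<forall>\<nu>\<in>P2. \<mu> \<preceq>cv \<nu> \<longrightarrow> diff_integral \<nu> \<mu> (D \<mu>) \<ge> 0)))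
    \<and> (\<forall>D. linear_functional_derivative \<Phi> D \<longrightarrow>
        (\<forall>\<mu>\<in>P2. convex_on UNIV (D \<mu>)) \<longrightarrow> cv_nondecreasing \<Phi>)"
  using cv_nondecreasing_iff_Liminf[OF assms] cv_nondecreasing_imp_diff_integral_nonneg
    cv_nondecreasing_if_diff_integral_nonneg cv_nondecreasing_if_convex_derivative
  by (intro conjI allI impI iffI ballI) blast+

end
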